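(* Let $\mathbf{k}$ be a unitary commutative ring, $H=\bigoplus_{n\ge 0}H_n$ a connected graded Hopf algebra over $\mathbf{k}$, and $(A,Q)$ a commutative Rota-Baxter algebra of weight $-1$ over $\mathbf{k}$ with $Q^2=Q$. Suppose $(V,p_V)$ is an $(A,Q)$-module and $\varphi\in\mathrm{Hom}_{\mathbf{k}\text{-}\mathrm{Alg}}(H,A)$, with algebraic Birkhoff factorization $\varphi_-\in\mathrm{Hom}_{\mathbf{k}\text{-}\mathrm{Alg}}(H,A_-)$, $\varphi_+=\varphi_-\ast\varphi\in\mathrm{Hom}_{\mathbf{k}\text{-}\mathrm{Alg}}(H,A_+)$. For each $\psi\in\mathrm{Hom}_\varphi(H,V)$ define $\psi_+(h)=\varphi_+(h)\psi(1)$ and $\psi_-(h)=\varphi_-(h)\psi(1)$ for $h\in H$. Then $\psi_+=\varphi_-\ast\psi\in\mathrm{Hom}_{\varphi_+}(H,A_+\psi(1))$ and $\psi_-\in\mathrm{Hom}_{\varphi_-}(H,A_-\psi(1))$.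
   Context: Algebras are unitary associative over $\mathbf{k}$. A Rota-Baxter algebra of weight $\lambda$ is a pair $(A,Q)$ with $Q:A\to A$ $\mathbf{k}$-linear and $Q(x)Q(y)=Q(xQ(y))+Q(Q(x)y)+\lambda Q(xy)$. An $(A,Q)$-module is a pair $(V,p_V)$ with $V$ a left $A$-module and $p_V:V\to V$ $\mathbf{k}$-linear with $Q(a)p_V(x)=p_V(ap_V(x))+p_V(Q(a)x)+\lambda p_V(ax)$. Put $\tilde Q=-\lambda\,\mathrm{id}_A-Q$ (so $\tilde Q=\mathrm{id}_A-Q$ for $\lambda=-1$), $A_-=\mathbf{k}+Q(A)$ and $A_+=\mathbf{k}+\tilde Q(A)$; these are subalgebras of $A$. A connected graded Hopf algebra is a Hopf algebra $H=\bigoplus_{n\ge0}H_n$ whose grading is compatible with multiplication and comultiplication and with $H_0=\mathbf{k}$. For $\varphi\in\mathrm{Hom}_{\mathbf{k}}(H,A)$ and $\psi\in\mathrm{Hom}_{\mathbf{k}}(H,A)$ or $\mathrm{Hom}_{\mathbf{k}}(H,V)$, $(\varphi\ast\psi)(h)=\sum_{(h)}\varphi(h_{(1)})\psi(h_{(2)})$, where $\Delta(h)=\sum_{(h)}h_{(1)}\otimes h_{(2)}$. The (known) algebraic Birkhoff factorization of Connes and Kreimer assigns to each algebra homomorphism $\varphi:H\to A$ an algebra homomorphism $\varphi_-:H\to A_-$ such that $\varphi_+:=\varphi_-\ast\varphi$ is an algebra homomorphism $H\to A_+$; the existence of such $\varphi_-$ may be assumed. For an algebra homomorphism $\chi:H\to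 B$ and a $B$-module $W$, $\mathrm{Hom}_\chi(H,W)$ is the set of $\chi$-linear maps, i.e. $\mathbf{k}$-linear $\psi:H\to W$ with $\psi(hx)=\chi(h)\psi(x)$ for all $h,x\in H$. For $v\in V$, $A_\pm v\subseteq V$ is the $A_\pm$-submodule generated by $v$. *)

theory Defs
  imports "HOL-Algebra.Module" "HOL-Algebra.Generated_Groups" "HOL-Algebra.Free_Abelian_Groups"
begin

section \<open>Linear maps and algebras over a commutative ring\<close>

definition linear_maps ::
  "'r ring \<Rightarrow> ('r, 'm) module \<Rightarrow> ('r, 'n) module \<Rightarrow> ('m \<Rightarrow> 'n) set"
  where "linear_maps R M N =
    {f \<in> carrier M \<rightarrow> carrier N.
      (\<forall>x\<in>carrier M. \<forall>y\<in>carrier M. f (x \<oplus>\<^bsub>M\<^esub> y) = f x \<oplus>\<^bsub>N\<^esub> f y) \<and>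
      (\<forall>c\<in>carrier R. \<forall>x\<in>carrier M. f (c \<odot>\<^bsub>M\<^esub> x) = c \<odot>\<^bsub>N\<^esub> f x)}"

text \<open>Unlike the locale \<^locale>\<open>algebra\<close> of the library, the algebra is not assumed to be
  commutative.\<close>

locale assoc_algebra = module R A + ring A
  for R :: "'r ring" and A :: "('r, 'a) module" +
  assumes smult_mult_left:
      "\<lbrakk>c \<in> carrier R; x \<in> carrier A; y \<in> carrier A\<rbrakk>
        \<Longrightarrow> (c \<odot>\<^bsub>A\<^esub> x) \<otimes>\<^bsub>A\<^esub> y = c \<odot>\<^bsub>A\<^esub> (x \<otimes>\<^bsub>A\<^esub> y)"
    and smult_mult_right:
      "\<lbrakk>c \<in> carrier R; x \<in> carrier A; y \<in> carrier A\<rbrakk>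
        \<Longrightarrow> x \<otimes>\<^bsub>A\<^esub> (c \<odot>\<^bsub>A\<^esub> y) = c \<odot>\<^bsub>A\<^esub> (x \<otimes>\<^bsub>A\<^esub> y)"

definition alg_hom ::
  "'r ring \<Rightarrow> ('r, 'a) module \<Rightarrow> ('r, 'b) module \<Rightarrow> ('a \<Rightarrow> 'b) set"
  where "alg_hom R A B = ring_hom A B \<inter> linear_maps R A B"

definition ring_as_module :: "'r ring \<Rightarrow> ('r, 'r) module"
  where "ring_as_module R =
    \<lparr>carrier = carrier R, monoid.mult = monoid.mult R, one = monoid.one R, ring.zero = ring.zero R, add = ring.add R, smult = monoid.mult R\<rparr>"

text \<open>A module over an \<open>R\<close>-algebra \<open>B\<close> is an \<open>R\<close>-module through \<open>R \<rightarrow> B\<close>, \<open>c \<mapsto> c \<sqdot> 1\<close>.\<close>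

definition restrict_scalars :: "('r, 'b) module \<Rightarrow> ('b, 'v) module \<Rightarrow> ('r, 'v) module"
  where "restrict_scalars B V =
    \<lparr>carrier = carrier V, monoid.mult = monoid.mult V, one = monoid.one V, ring.zero = ring.zero V, add = ring.add V,
     smult = (\<lambda>c v. (c \<odot>\<^bsub>B\<^esub> \<one>\<^bsub>B\<^esub>) \<odot>\<^bsub>V\<^esub> v)\<rparr>"

section \<open>Tensor products\<close>

definition tensor_rels ::
  "'r ring \<Rightarrow> ('r, 'm) module \<Rightarrow> ('r, 'n) module \<Rightarrow> ('m \<times> 'n \<Rightarrow>\<^sub>0 int) set"
  where "tensor_rels R M N =
    generate (free_Abelian_group (carrier M \<times> carrier N))
     ({frag_of (x \<oplus>\<^bsub>M\<^esub> x', y) - frag_of (x, y) - frag_of (x', y) | x x' y.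
         x \<in> carrier M \<and> x' \<in> carrier M \<and> y \<in> carrier N} \<union>
      {frag_of (x, y \<oplus>\<^bsub>N\<^esub> y') - frag_of (x, y) - frag_of (x, y') | x y y'.
         x \<in> carrier M \<and> y \<in> carrier N \<and> y' \<in> carrier N} \<union>
      {frag_of (c \<odot>\<^bsub>M\<^esub> x, y) - frag_of (x, c \<odot>\<^bsub>N\<^esub> y) | c x y.
         c \<in> carrier R \<and> x \<in> carrier M \<and> y \<in> carrier N})"

definition tensor_group ::
  "'r ring \<Rightarrow> ('r, 'm) module \<Rightarrow> ('r, 'n) module \<Rightarrow> ('m \<times> 'n \<Rightarrow>\<^sub>0 int) set monoid"
  where "tensor_group R M N =
    free_Abelian_group (carrier M \<times> carrier N) Mod tensor_rels R M N"

definition pure_tensor ::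
  "'r ring \<Rightarrow> ('r, 'm) module \<Rightarrow> ('r, 'n) module \<Rightarrow> 'm \<Rightarrow> 'n \<Rightarrow> ('m \<times> 'n \<Rightarrow>\<^sub>0 int) set"
  where "pure_tensor R M N x y =
    tensor_rels R M N #>\<^bsub>free_Abelian_group (carrier M \<times> carrier N)\<^esub> frag_of (x, y)"

text \<open>The additive map induced by a balanced biadditive map \<open>b\<close> into the abelian group \<open>G\<close>:
  the class of \<open>\<Sum> n\<^sub>i (x\<^sub>i, y\<^sub>i)\<close> goes to the \<open>G\<close>-combination \<open>\<Sum> n\<^sub>i b (x\<^sub>i, y\<^sub>i)\<close>, which does not
  depend on the representative, so that the image of the class is a singleton.\<close>

definition tensor_lift ::
  "('g, 'z) monoid_scheme \<Rightarrow> ('m \<times> 'n \<Rightarrow> 'g) \<Rightarrow> ('m \<times> 'n \<Rightarrow>\<^sub>0 int) set \<Rightarrow> 'g"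
  where "tensor_lift G b X =
    the_elem ((\<lambda>f. \<Otimes>\<^bsub>G\<^esub>p\<in>Poly_Mapping.keys f. b p [^]\<^bsub>G\<^esub> Poly_Mapping.lookup f p) ` X)"

text \<open>The tensor product as an \<open>R\<close>-module, with the multiplication
  \<open>(x \<otimes> y)(x' \<otimes> y') = xx' \<otimes> yy'\<close>, which is meaningful when both factors are algebras.\<close>

definition tensor ::
  "'r ring \<Rightarrow> ('r, 'm) module \<Rightarrow> ('r, 'n) module \<Rightarrow> ('r, ('m \<times> 'n \<Rightarrow>\<^sub>0 int) set) module"
  where "tensor R M N =
    \<lparr>carrier = carrier (tensor_group R M N),
     monoid.mult = (\<lambda>X Y. tensor_lift (tensor_group R M N)
        (\<lambda>(x, y). tensor_lift (tensor_group R M N)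
          (\<lambda>(x', y'). pure_tensor R M N (x \<otimes>\<^bsub>M\<^esub> x') (y \<otimes>\<^bsub>N\<^esub> y')) Y) X),
     one = pure_tensor R M N \<one>\<^bsub>M\<^esub> \<one>\<^bsub>N\<^esub>,
     ring.zero = \<one>\<^bsub>tensor_group R M N\<^esub>,
     add = monoid.mult (tensor_group R M N),
     smult = (\<lambda>c. tensor_lift (tensor_group R M N) (\<lambda>(x, y). pure_tensor R M N (c \<odot>\<^bsub>M\<^esub> x) y))\<rparr>"

definition tensor_map ::
  "'r ring \<Rightarrow> ('r, 'p) module \<Rightarrow> ('r, 'q) module \<Rightarrow> ('m \<Rightarrow> 'p) \<Rightarrow> ('n \<Rightarrow> 'q) \<Rightarrow>
    ('m \<times> 'n \<Rightarrow>\<^sub>0 int) set \<Rightarrow> ('p \<times> 'q \<Rightarrow>\<^sub>0 int) set"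
  where "tensor_map R P Q f g =
    tensor_lift (tensor_group R P Q) (\<lambda>(x, y). pure_tensor R P Q (f x) (g y))"

text \<open>The associator \<open>(L \<otimes> M) \<otimes> N \<rightarrow> L \<otimes> (M \<otimes> N)\<close>.\<close>

definition tensor_assoc ::
  "'r ring \<Rightarrow> ('r, 'l) module \<Rightarrow> ('r, 'm) module \<Rightarrow> ('r, 'n) module \<Rightarrow>
    (('l \<times> 'm \<Rightarrow>\<^sub>0 int) set \<times> 'n \<Rightarrow>\<^sub>0 int) set \<Rightarrow> ('l \<times> ('m \<times> 'n \<Rightarrow>\<^sub>0 int) set \<Rightarrow>\<^sub>0 int) set"
  where "tensor_assoc R L M N =
    tensor_lift (tensor_group R L (tensor R M N))
      (\<lambda>(X, z). tensor_lift (tensor_group R L (tensor R M N))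
        (\<lambda>(x, y). pure_tensor R L (tensor R M N) x (pure_tensor R M N y z)) X)"

section \<open>Hopf algebras\<close>

locale coalgebra = module R C
  for R :: "'r ring" and C :: "('r, 'c) module"
    and \<Delta> :: "'c \<Rightarrow> ('c \<times> 'c \<Rightarrow>\<^sub>0 int) set" and \<epsilon> :: "'c \<Rightarrow> 'r" +
  assumes comult_linear: "\<Delta> \<in> linear_maps R C (tensor R C C)"
    and counit_linear: "\<epsilon> \<in> linear_maps R C (ring_as_module R)"
    and coassoc: "c \<in> carrier C \<Longrightarrow>
      tensor_assoc R C C C (tensor_map R (tensor R C C) C \<Delta> (\<lambda>x. x) (\<Delta> c)) =
      tensor_map R C (tensor R C C) (\<lambda>x. x) \<Delta> (\<Delta> c)"
    and counit_left: "c \<in> carrier C \<Longrightarrow>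
      tensor_lift (add_monoid C) (\<lambda>(x, y). \<epsilon> x \<odot>\<^bsub>C\<^esub> y) (\<Delta> c) = c"
    and counit_right: "c \<in> carrier C \<Longrightarrow>
      tensor_lift (add_monoid C) (\<lambda>(x, y). \<epsilon> y \<odot>\<^bsub>C\<^esub> x) (\<Delta> c) = c"

locale bialgebra = assoc_algebra R H + coalgebra R H \<Delta> \<epsilon>
  for R :: "'r ring" and H :: "('r, 'h) module"
    and \<Delta> :: "'h \<Rightarrow> ('h \<times> 'h \<Rightarrow>\<^sub>0 int) set" and \<epsilon> :: "'h \<Rightarrow> 'r" +
  assumes comult_hom: "\<Delta> \<in> alg_hom R H (tensor R H H)"
    and counit_hom: "\<epsilon> \<in> alg_hom R H (ring_as_module R)"

text \<open>The convolution \<open>\<Sum> \<phi>(h\<^sub>1) \<psi>(h\<^sub>2)\<close> of maps \<open>\<phi>\<close> and \<open>\<psi>\<close> on a coalgebra, where the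
  values are paired by \<open>act\<close> into \<open>P\<close>: the multiplication of an algebra, or the action of
  an algebra on a module.\<close>

definition convolution ::
  "('h \<Rightarrow> ('h \<times> 'h \<Rightarrow>\<^sub>0 int) set) \<Rightarrow> ('s, 'p) module \<Rightarrow> ('a \<Rightarrow> 'b \<Rightarrow> 'p) \<Rightarrow>
    ('h \<Rightarrow> 'a) \<Rightarrow> ('h \<Rightarrow> 'b) \<Rightarrow> 'h \<Rightarrow> 'p"
  where "convolution \<Delta> P act \<phi> \<psi> h =
    tensor_lift (add_monoid P) (\<lambda>(x, y). act (\<phi> x) (\<psi> y)) (\<Delta> h)"

locale hopf_algebra = bialgebra R H \<Delta> \<epsilon>
  for R :: "'r ring" and H :: "('r, 'h) module"
    and \<Delta> :: "'h \<Rightarrow> ('h \<times> 'h \<Rightarrow>\<^sub>0 int) set" and \<epsilon> :: "'h \<Rightarrow> 'r" and S :: "'h \<Rightarrow> 'h" +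
  assumes antipode_linear: "S \<in> linear_maps R H H"
    and antipode_left: "h \<in> carrier H \<Longrightarrow>
      convolution \<Delta> H (monoid.mult H) S (\<lambda>x. x) h = \<epsilon> h \<odot>\<^bsub>H\<^esub> \<one>\<^bsub>H\<^esub>"
    and antipode_right: "h \<in> carrier H \<Longrightarrow>
      convolution \<Delta> H (monoid.mult H) (\<lambda>x. x) S h = \<epsilon> h \<odot>\<^bsub>H\<^esub> \<one>\<^bsub>H\<^esub>"

text \<open>\<open>Hn n\<close> is the homogeneous component of degree \<open>n\<close>. The additive subgroup generated by the
  tensors \<open>x \<otimes> y\<close> with \<open>x\<close>, \<open>y\<close> homogeneous of degrees adding up to \<open>n\<close> is the degree \<open>n\<close>
  component of \<open>H \<otimes> H\<close>. The condition \<open>H\<^sub>0 = R\<close> says that the unit map is a bijection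
  onto \<open>H\<^sub>0\<close>.\<close>

locale connected_graded_hopf_algebra = hopf_algebra R H \<Delta> \<epsilon> S
  for R :: "'r ring" and H :: "('r, 'h) module"
    and \<Delta> :: "'h \<Rightarrow> ('h \<times> 'h \<Rightarrow>\<^sub>0 int) set" and \<epsilon> :: "'h \<Rightarrow> 'r" and S :: "'h \<Rightarrow> 'h"
    and Hn :: "nat \<Rightarrow> 'h set" +
  assumes component_submodule: "submodule (Hn n) R H"
    and direct_sum: "h \<in> carrier H \<Longrightarrow>
      \<exists>!d. (\<forall>n. d n \<in> Hn n) \<and> finite {n. d n \<noteq> \<zero>\<^bsub>H\<^esub>} \<and>
        h = (\<Oplus>\<^bsub>H\<^esub>n\<in>{n. d n \<noteq> \<zero>\<^bsub>H\<^esub>}. d n)"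
    and graded_mult: "\<lbrakk>x \<in> Hn m; y \<in> Hn n\<rbrakk> \<Longrightarrow> x \<otimes>\<^bsub>H\<^esub> y \<in> Hn (m + n)"
    and graded_comult: "h \<in> Hn n \<Longrightarrow>
      \<Delta> h \<in> generate (tensor_group R H H)
        {pure_tensor R H H x y | x y i j. x \<in> Hn i \<and> y \<in> Hn j \<and> i + j = n}"
    and connected: "bij_betw (\<lambda>c. c \<odot>\<^bsub>H\<^esub> \<one>\<^bsub>H\<^esub>) (carrier R) (Hn 0)"

section \<open>Rota-Baxter algebras and modules\<close>

locale rota_baxter_algebra = assoc_algebra R A
  for R :: "'r ring" and A :: "('r, 'a) module" and Q :: "'a \<Rightarrow> 'a" and wt :: 'r +
  assumes weight_closed: "wt \<in> carrier R"
    and operator_linear: "Q \<in> linear_maps R A A"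
    and rota_baxter: "\<lbrakk>x \<in> carrier A; y \<in> carrier A\<rbrakk> \<Longrightarrow>
      Q x \<otimes>\<^bsub>A\<^esub> Q y =
        Q (x \<otimes>\<^bsub>A\<^esub> Q y) \<oplus>\<^bsub>A\<^esub> Q (Q x \<otimes>\<^bsub>A\<^esub> y) \<oplus>\<^bsub>A\<^esub> wt \<odot>\<^bsub>A\<^esub> Q (x \<otimes>\<^bsub>A\<^esub> y)"

text \<open>Modules in the library are over commutative rings, so \<open>A\<close> is commutative here.\<close>

locale rota_baxter_module = rota_baxter_algebra R A Q wt + V: module A V
  for R :: "'r ring" and A :: "('r, 'a) module" and Q :: "'a \<Rightarrow> 'a" and wt :: 'r
    and V :: "('a, 'v) module" and p :: "'v \<Rightarrow> 'v" +
  assumes module_operator_linear: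
      "p \<in> linear_maps R (restrict_scalars A V) (restrict_scalars A V)"
    and module_rota_baxter: "\<lbrakk>a \<in> carrier A; x \<in> carrier V\<rbrakk> \<Longrightarrow>
      Q a \<odot>\<^bsub>V\<^esub> p x =
        p (a \<odot>\<^bsub>V\<^esub> p x) \<oplus>\<^bsub>V\<^esub> p (Q a \<odot>\<^bsub>V\<^esub> x)
          \<oplus>\<^bsub>V\<^esub> wt \<odot>\<^bsub>restrict_scalars A V\<^esub> p (a \<odot>\<^bsub>V\<^esub> x)"

definition rb_tilde :: "('r, 'a) module \<Rightarrow> ('a \<Rightarrow> 'a) \<Rightarrow> 'r \<Rightarrow> 'a \<Rightarrow> 'a"
  where "rb_tilde A Q wt a = \<ominus>\<^bsub>A\<^esub> (wt \<odot>\<^bsub>A\<^esub> a) \<ominus>\<^bsub>A\<^esub> Q a"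

definition rb_minus :: "'r ring \<Rightarrow> ('r, 'a) module \<Rightarrow> ('a \<Rightarrow> 'a) \<Rightarrow> ('r, 'a) module"
  where "rb_minus R A Q =
    A\<lparr>carrier := {c \<odot>\<^bsub>A\<^esub> \<one>\<^bsub>A\<^esub> \<oplus>\<^bsub>A\<^esub> Q a | c a. c \<in> carrier R \<and> a \<in> carrier A}\<rparr>"

definition rb_plus :: "'r ring \<Rightarrow> ('r, 'a) module \<Rightarrow> ('a \<Rightarrow> 'a) \<Rightarrow> 'r \<Rightarrow> ('r, 'a) module"
  where "rb_plus R A Q wt =
    A\<lparr>carrier := {c \<odot>\<^bsub>A\<^esub> \<one>\<^bsub>A\<^esub> \<oplus>\<^bsub>A\<^esub> rb_tilde A Q wt a | c a. c \<in> carrier R \<and> a \<in> carrier A}\<rparr>"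

definition birkhoff_factorization ::
  "'r ring \<Rightarrow> ('r, 'h) module \<Rightarrow> ('h \<Rightarrow> ('h \<times> 'h \<Rightarrow>\<^sub>0 int) set) \<Rightarrow>
    ('r, 'a) module \<Rightarrow> ('a \<Rightarrow> 'a) \<Rightarrow> 'r \<Rightarrow> ('h \<Rightarrow> 'a) \<Rightarrow> ('h \<Rightarrow> 'a) \<Rightarrow> ('h \<Rightarrow> 'a) \<Rightarrow> bool"
  where "birkhoff_factorization R H \<Delta> A Q wt \<phi> \<phi>m \<phi>p \<longleftrightarrow>
    \<phi>m \<in> alg_hom R H (rb_minus R A Q) \<and>
    \<phi>p \<in> alg_hom R H (rb_plus R A Q wt) \<and>
    (\<forall>h\<in>carrier H. \<phi>p h = convolution \<Delta> A (monoid.mult A) \<phi>m \<phi> h)"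

section \<open>Linear maps along an algebra homomorphism\<close>

definition hom_along ::
  "'r ring \<Rightarrow> ('r, 'h) module \<Rightarrow> ('r, 'b) module \<Rightarrow> ('h \<Rightarrow> 'b) \<Rightarrow> ('b, 'w) module \<Rightarrow> ('h \<Rightarrow> 'w) set"
  where "hom_along R H B \<chi> W =
    {\<psi> \<in> linear_maps R H (restrict_scalars B W).
      \<forall>h\<in>carrier H. \<forall>x\<in>carrier H. \<psi> (h \<otimes>\<^bsub>H\<^esub> x) = \<chi> h \<odot>\<^bsub>W\<^esub> \<psi> x}"

definition generated_submodule :: "('r, 'b) module \<Rightarrow> ('b, 'v) module \<Rightarrow> 'v \<Rightarrow> ('b, 'v) module"
  where "generated_submodule B V v = V\<lparr>carrier := \<Inter>{W. submodule W B V \<and> v \<in> W}\<rparr>"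

end

theory Submission
  imports Defs
begin

text \<open>For \<open>\<psi> \<in> Hom\<^sub>\<phi>(H, V)\<close> one has \<open>\<psi>(y) = \<psi>(y1) = \<phi>(y)\<psi>(1)\<close>. Applying the additive map
  \<open>A \<rightarrow> V\<close>, \<open>a \<mapsto> a\<psi>(1)\<close>, to \<open>(\<phi>\<^sub>- \<ast> \<phi>)(h)\<close> therefore gives \<open>(\<phi>\<^sub>- \<ast> \<psi>)(h)\<close>, since maps induced
  on a tensor product are natural in their target. The remaining claims hold for any algebra
  homomorphism into a subalgebra of \<open>A\<close>.\<close>

section \<open>Additive extension from a free abelian group\<close>

text \<open>The formula inside \<open>tensor_lift\<close> for a single representative, isolated so
  that its independence of the representative can be stated and proved.\<close>

definition frag_eval :: "('g, 'z) monoid_scheme \<Rightarrow> ('a \<Rightarrow> 'g) \<Rightarrow> ('a \<Rightarrow>\<^sub>0 int) \<Rightarrow> 'g"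
  where "frag_eval G b f =
    (\<Otimes>\<^bsub>G\<^esub>p\<in>Poly_Mapping.keys f. b p [^]\<^bsub>G\<^esub> Poly_Mapping.lookup f p)"

lemma tensor_lift_frag_eval: "tensor_lift G b X = the_elem (frag_eval G b ` X)"
  by (simp add: tensor_lift_def frag_eval_def[abs_def])

context comm_group
begin

text \<open>Points outside the support have exponent 0 and contribute the unit. Combinations with
  different supports can thus be evaluated over one index set.\<close>

lemma frag_eval_superset:
  assumes "finite K" "Poly_Mapping.keys f \<subseteq> K" "b \<in> K \<rightarrow> carrier G"
  shows "frag_eval G b f = (\<Otimes>p\<in>K. b p [^] Poly_Mapping.lookup f p)"
  unfolding frag_eval_def
  by (rule finprod_mono_neutral_cong_left) (use assms in \<open>auto simp: in_keys_iff\<close>)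

lemma frag_eval_hom:
  assumes b: "b \<in> S \<rightarrow> carrier G"
  shows "frag_eval G b \<in> hom (free_Abelian_group S) G"
proof (rule homI)
  fix f assume "f \<in> carrier (free_Abelian_group S)"
  then show "frag_eval G b f \<in> carrier G"
    using b unfolding frag_eval_def by (intro finprod_closed) auto
next
  fix f g assume "f \<in> carrier (free_Abelian_group S)" "g \<in> carrier (free_Abelian_group S)"
  then have fg: "Poly_Mapping.keys f \<subseteq> S" "Poly_Mapping.keys g \<subseteq> S" by simp_all
  \<comment> \<open>A common index set is required because cancellation can make the support of
    \<open>f + g\<close> smaller than this union.\<close>
  let ?K = "Poly_Mapping.keys f \<union> Poly_Mapping.keys g"
  have K: "finite ?K" "b \<in> ?K \<rightarrow> carrier G" using b fg by auto
  have "frag_eval G b (f + g) = (\<Otimes>p\<in>?K. b p [^] Poly_Mapping.lookup (f + g) p)"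
    using K keys_add by (intro frag_eval_superset)
  also have "\<dots> = (\<Otimes>p\<in>?K. b p [^] Poly_Mapping.lookup f p \<otimes> b p [^] Poly_Mapping.lookup g p)"
    using K(2) by (intro finprod_cong') (auto simp: lookup_add int_pow_mult Pi_iff)
  also have "\<dots> = (\<Otimes>p\<in>?K. b p [^] Poly_Mapping.lookup f p) \<otimes> (\<Otimes>p\<in>?K. b p [^] Poly_Mapping.lookup g p)"
    using K(2) by (intro finprod_multf) (auto simp: Pi_iff)
  also have "\<dots> = frag_eval G b f \<otimes> frag_eval G b g"
    using K by (simp add: frag_eval_superset[of ?K])
  finally show "frag_eval G b (f \<otimes>\<^bsub>free_Abelian_group S\<^esub> g) = frag_eval G b f \<otimes> frag_eval G b g"
    by simp
qed

lemma frag_eval_of [simp]: "b x \<in> carrier G \<Longrightarrow> frag_eval G b (frag_of x) = b x"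
  by (simp add: frag_eval_def finprod_insert)

text \<open>A homomorphism preserves inverses, and the inverse in the free abelian group is
  negation. The generators of \<open>tensor_rels\<close> are written as such differences.\<close>

lemma frag_eval_diff:
  assumes "b \<in> S \<rightarrow> carrier G" "Poly_Mapping.keys f \<subseteq> S" "Poly_Mapping.keys g \<subseteq> S"
  shows "frag_eval G b (f - g) = frag_eval G b f \<otimes> inv (frag_eval G b g)"
proof -
  interpret group_hom "free_Abelian_group S" G "frag_eval G b"
    by (simp add: group_hom_def group_hom_axioms_def frag_eval_hom assms is_group)
  show ?thesis
    using assms hom_mult[of f "- g"] hom_inv[of g] by simp
qed

end

section \<open>Balanced maps and induced maps on tensor products\<close>

text \<open>The three equations match the three families of generators of
  \<open>tensor_rels\<close>. The target is a multiplicatively written abelian group, as in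
  \<open>tensor_lift\<close>; an additive target enters through \<open>add_monoid\<close>.\<close>

locale balanced_map = M: module R M + N: module R N + comm_group G
  for R :: "'r ring" and M :: "('r, 'm) module" and N :: "('r, 'n) module"
    and G :: "('g, 'z) monoid_scheme" and b :: "'m \<times> 'n \<Rightarrow> 'g" +
  assumes closed: "\<lbrakk>x \<in> carrier M; y \<in> carrier N\<rbrakk> \<Longrightarrow> b (x, y) \<in> carrier G"
    and add_left: "\<lbrakk>x \<in> carrier M; x' \<in> carrier M; y \<in> carrier N\<rbrakk> \<Longrightarrow>
      b (x \<oplus>\<^bsub>M\<^esub> x', y) = b (x, y) \<otimes>\<^bsub>G\<^esub> b (x', y)"
    and add_right: "\<lbrakk>x \<in> carrier M; y \<in> carrier N; y' \<in> carrier N\<rbrakk> \<Longrightarrow>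
      b (x, y \<oplus>\<^bsub>N\<^esub> y') = b (x, y) \<otimes>\<^bsub>G\<^esub> b (x, y')"
    and balanced: "\<lbrakk>c \<in> carrier R; x \<in> carrier M; y \<in> carrier N\<rbrakk> \<Longrightarrow>
      b (c \<odot>\<^bsub>M\<^esub> x, y) = b (x, c \<odot>\<^bsub>N\<^esub> y)"
begin

text \<open>The kernel of \<open>frag_eval G b\<close> is a subgroup containing every generator of
  the relations, hence the subgroup they generate.\<close>

lemma frag_eval_tensor_rels:
  assumes "f \<in> tensor_rels R M N"
  shows "Poly_Mapping.keys f \<subseteq> carrier M \<times> carrier N" "frag_eval G b f = \<one>\<^bsub>G\<^esub>"
proof -
  let ?F = "free_Abelian_group (carrier M \<times> carrier N)"
  have b: "b \<in> carrier M \<times> carrier N \<rightarrow> carrier G"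
    using closed by auto
  interpret e: group_hom ?F G "frag_eval G b"
    by (simp add: group_hom_def group_hom_axioms_def frag_eval_hom b is_group)
  have diff: "Poly_Mapping.keys (g - h) \<subseteq> carrier M \<times> carrier N"
    if "Poly_Mapping.keys g \<subseteq> carrier M \<times> carrier N" "Poly_Mapping.keys h \<subseteq> carrier M \<times> carrier N"
    for g h :: "'m \<times> 'n \<Rightarrow>\<^sub>0 int"
    using that keys_diff[of g h] by blast
  \<comment> \<open>This is the value of a relation \<open>u - v - w\<close> once \<open>b u\<close>
    is replaced by the product of \<open>b v\<close> and \<open>b w\<close>.\<close>
  have cancel: "a \<otimes>\<^bsub>G\<^esub> c \<otimes>\<^bsub>G\<^esub> inv\<^bsub>G\<^esub> a \<otimes>\<^bsub>G\<^esub> inv\<^bsub>G\<^esub> c = \<one>\<^bsub>G\<^esub>"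
    if "a \<in> carrier G" "c \<in> carrier G" for a c
    using that by (simp add: m_assoc[of "a \<otimes>\<^bsub>G\<^esub> c"] flip: inv_mult)
  have add_rel: "frag_of u - frag_of v - frag_of w \<in> kernel ?F G (frag_eval G b)"
    if "{u, v, w} \<subseteq> carrier M \<times> carrier N" "b u = b v \<otimes>\<^bsub>G\<^esub> b w" for u v w
  proof -
    have "b u \<in> carrier G" "b v \<in> carrier G" "b w \<in> carrier G"
      using that b by auto
    then show ?thesis
      using that by (simp add: kernel_def diff frag_eval_diff[OF b] cancel)
  qed
  have balanced_rel: "frag_of u - frag_of v \<in> kernel ?F G (frag_eval G b)"
    if "{u, v} \<subseteq> carrier M \<times> carrier N" "b u = b v" for u v
  proof -
    have "b v \<in> carrier G"
      using that b by auto
    then show ?thesis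
      using that by (simp add: kernel_def diff frag_eval_diff[OF b])
  qed
  have "tensor_rels R M N \<subseteq> kernel ?F G (frag_eval G b)"
    unfolding tensor_rels_def
    by (rule group.generate_subgroup_incl[OF group_free_Abelian_group _ e.subgroup_kernel])
      (auto intro!: add_rel balanced_rel simp: add_left add_right balanced)
  then show "Poly_Mapping.keys f \<subseteq> carrier M \<times> carrier N" "frag_eval G b f = \<one>\<^bsub>G\<^esub>"
    using assms by (auto simp: kernel_def)
qed

text \<open>Members of a coset differ by a relation, whose value is trivial. This is what makes
  \<open>the_elem\<close> in \<open>tensor_lift\<close> well defined.\<close>

lemma tensor_group_coset:
  assumes "X \<in> carrier (tensor_group R M N)"
  obtains f where "f \<in> X" "\<And>g. g \<in> X \<Longrightarrow> Poly_Mapping.keys g \<subseteq> carrier M \<times> carrier N"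
    "\<And>g. g \<in> X \<Longrightarrow> frag_eval G b g = frag_eval G b f"
proof -
  let ?F = "free_Abelian_group (carrier M \<times> carrier N)"
  have b: "b \<in> carrier M \<times> carrier N \<rightarrow> carrier G"
    using closed by auto
  interpret e: group_hom ?F G "frag_eval G b"
    by (simp add: group_hom_def group_hom_axioms_def frag_eval_hom b is_group)
  obtain f where f: "Poly_Mapping.keys f \<subseteq> carrier M \<times> carrier N" "X = tensor_rels R M N #>\<^bsub>?F\<^esub> f"
    using assms by (auto simp: tensor_group_def FactGroup_def RCOSETS_def)
  show ?thesis
  proof
    have "0 \<in> tensor_rels R M N"
      unfolding tensor_rels_def using generate.one[of ?F] by simp
    then show "f \<in> X" using f by (auto simp: r_coset_def)
  next
    fix g assume "g \<in> X"
    then obtain r where r: "r \<in> tensor_rels R M N" "g = r \<otimes>\<^bsub>?F\<^esub> f"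
      using f(2) by (auto simp: r_coset_def)
    note rels = frag_eval_tensor_rels[OF r(1)]
    show "Poly_Mapping.keys g \<subseteq> carrier M \<times> carrier N"
      using r(2) rels(1) f(1) keys_add[of r f] by auto
    have "frag_eval G b g = frag_eval G b r \<otimes>\<^bsub>G\<^esub> frag_eval G b f"
      unfolding r(2) using rels(1) f(1) by (intro e.hom_mult) auto
    then show "frag_eval G b g = frag_eval G b f"
      using rels(2) e.hom_closed f(1) by simp
  qed
qed

text \<open>A homomorphism commutes with finite products and integer powers, so on each
  representative \<open>b'\<close> evaluates to the \<theta>-image of the value of \<open>b\<close>.
  Constancy on the coset passes from \<open>b\<close> to \<open>b'\<close>.\<close>

lemma tensor_lift_natural:
  assumes "comm_group K" and \<theta>: "\<theta> \<in> hom G K"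
    and eq: "\<And>x y. \<lbrakk>x \<in> carrier M; y \<in> carrier N\<rbrakk> \<Longrightarrow> b' (x, y) = \<theta> (b (x, y))"
    and X: "X \<in> carrier (tensor_group R M N)"
  shows "tensor_lift K b' X = \<theta> (tensor_lift G b X)"
proof -
  interpret K: comm_group K by fact
  interpret \<theta>: group_hom G K \<theta>
    by (simp add: group_hom_def group_hom_axioms_def \<theta> is_group K.is_group)
  obtain f where f: "f \<in> X" "\<And>g. g \<in> X \<Longrightarrow> Poly_Mapping.keys g \<subseteq> carrier M \<times> carrier N"
    "\<And>g. g \<in> X \<Longrightarrow> frag_eval G b g = frag_eval G b f"
    using tensor_group_coset[OF X] by blast
  have \<theta>_finprod: "\<theta> (\<Otimes>\<^bsub>G\<^esub>p\<in>T. b p [^]\<^bsub>G\<^esub> n p) = (\<Otimes>\<^bsub>K\<^esub>p\<in>T. b' p [^]\<^bsub>K\<^esub> n p)"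
    if "finite T" "T \<subseteq> carrier M \<times> carrier N" for T and n :: "'m \<times> 'n \<Rightarrow> int"
    using that
  proof induction
    case empty
    show ?case by simp
  next
    case (insert q T)
    have bc: "b p \<in> carrier G" "b' p = \<theta> (b p)" if "p \<in> insert q T" for p
      using that insert.prems closed eq by auto
    show ?case
      using insert bc by (simp add: finprod_insert K.finprod_insert Pi_iff \<theta>.hom_int_pow)
  qed
  have "frag_eval K b' g = \<theta> (frag_eval G b f)" if "g \<in> X" for g
  proof -
    have "\<theta> (frag_eval G b g) = frag_eval K b' g"
      unfolding frag_eval_def by (rule \<theta>_finprod) (use f(2)[OF that] in simp_all)
    then show ?thesis by (simp add: f(3)[OF that])
  qed
  then have "frag_eval K b' ` X = (\<lambda>_. \<theta> (frag_eval G b f)) ` X"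
    "frag_eval G b ` X = (\<lambda>_. frag_eval G b f) ` X"
    by (intro image_cong refl f(3); simp)+
  \<comment> \<open>A constant image is a singleton only for a nonempty coset; the member
    \<open>f\<close> supplies this.\<close>
  then have "frag_eval K b' ` X = {\<theta> (frag_eval G b f)}" "frag_eval G b ` X = {frag_eval G b f}"
    using f(1) by (auto simp only: image_constant)
  then show ?thesis
    by (simp add: tensor_lift_frag_eval)
qed

end

section \<open>The Birkhoff targets and orbit maps into generated submodules\<close>

lemma carrier_rb_minus:
  assumes "rota_baxter_algebra R A Q wt"
  shows "carrier (rb_minus R A Q) \<subseteq> carrier A"
proof -
  interpret rota_baxter_algebra R A Q wt by fact
  have "Q a \<in> carrier A" if "a \<in> carrier A" for a
    using operator_linear that by (auto simp: linear_maps_def)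
  then show ?thesis by (auto simp: rb_minus_def)
qed

lemma carrier_rb_plus:
  assumes "rota_baxter_algebra R A Q wt"
  shows "carrier (rb_plus R A Q wt) \<subseteq> carrier A"
proof -
  interpret rota_baxter_algebra R A Q wt by fact
  have "Q a \<in> carrier A" if "a \<in> carrier A" for a
    using operator_linear that by (auto simp: linear_maps_def)
  then show ?thesis using weight_closed by (auto simp: rb_plus_def rb_tilde_def)
qed

text \<open>Multiplicativity of \<chi> and associativity of the action give \<chi>-linearity. Every
  \<open>B\<close>-submodule containing \<open>v\<close> is closed under scalars from
  \<open>C\<close>, hence contains the whole orbit. Since \<open>B\<close> only restricts the
  carrier, the operations and module laws of \<open>A\<close> still apply.\<close>

lemma alg_hom_orbit_in_hom_along:
  assumes "assoc_algebra R A" "module A V" "B = A\<lparr>carrier := C\<rparr>" "C \<subseteq> carrier A"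
    and \<chi>: "\<chi> \<in> alg_hom R H B" and v: "v \<in> carrier V"
  shows "(\<lambda>h. \<chi> h \<odot>\<^bsub>V\<^esub> v) \<in> hom_along R H B \<chi> (generated_submodule B V v)"
proof -
  interpret A: assoc_algebra R A by fact
  interpret V: module A V by fact
  have C: "\<chi> h \<in> C" if "h \<in> carrier H" for h
    using \<chi> that assms(3) by (auto simp: alg_hom_def ring_hom_def)
  then have closed: "\<chi> h \<in> carrier A" if "h \<in> carrier H" for h
    using that assms(4) by blast
  have mult: "\<chi> (h \<otimes>\<^bsub>H\<^esub> x) = \<chi> h \<otimes>\<^bsub>A\<^esub> \<chi> x" and add: "\<chi> (h \<oplus>\<^bsub>H\<^esub> x) = \<chi> h \<oplus>\<^bsub>A\<^esub> \<chi> x"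
    if "h \<in> carrier H" "x \<in> carrier H" for h x
    using \<chi> that assms(3) by (auto simp: alg_hom_def ring_hom_def)
  have smult: "\<chi> (c \<odot>\<^bsub>H\<^esub> h) = c \<odot>\<^bsub>A\<^esub> \<chi> h" if "c \<in> carrier R" "h \<in> carrier H" for c h
    using \<chi> that assms(3) by (auto simp: alg_hom_def linear_maps_def)
  \<comment> \<open>\<open>R\<close> acts on \<open>V\<close> through \<open>c\<close> times the
    unit of \<open>A\<close>, so homogeneity over \<open>R\<close> reduces to this identity.\<close>
  have scalar: "(c \<odot>\<^bsub>A\<^esub> a) \<odot>\<^bsub>V\<^esub> v = (c \<odot>\<^bsub>A\<^esub> \<one>\<^bsub>A\<^esub>) \<odot>\<^bsub>V\<^esub> (a \<odot>\<^bsub>V\<^esub> v)"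
    if "c \<in> carrier R" "a \<in> carrier A" for c a
    using that v A.smult_mult_left[of c "\<one>\<^bsub>A\<^esub>" a] by (simp flip: V.smult_assoc1)
  have "\<chi> h \<odot>\<^bsub>V\<^esub> v \<in> W" if "h \<in> carrier H" "submodule W B V" "v \<in> W" for h W
    using submodule.smult_closed[OF that(2)] C[OF that(1)] that(3) assms(3) by simp
  then show ?thesis
    using v closed assms(3)
    by (auto simp: hom_along_def linear_maps_def restrict_scalars_def generated_submodule_def
        mult add smult scalar V.smult_l_distr V.smult_assoc1)
qed

section \<open>Convolution with a map linear along an algebra homomorphism\<close>

lemma convolution_hom_along:
  assumes "assoc_algebra R A" "module A V" "bialgebra R H \<Delta> \<epsilon>"
    and \<chi>: "\<chi> \<in> linear_maps R H A" and \<phi>: "\<phi> \<in> linear_maps R H A"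
    and \<psi>: "\<psi> \<in> hom_along R H A \<phi> V" and h: "h \<in> carrier H"
  shows "convolution \<Delta> V (smult V) \<chi> \<psi> h =
    convolution \<Delta> A (monoid.mult A) \<chi> \<phi> h \<odot>\<^bsub>V\<^esub> \<psi> \<one>\<^bsub>H\<^esub>"
proof -
  interpret A: assoc_algebra R A by fact
  interpret V: module A V by fact
  interpret H: bialgebra R H \<Delta> \<epsilon> by fact
  note lin = \<chi>[unfolded linear_maps_def] \<phi>[unfolded linear_maps_def]
  \<comment> \<open>Linearity of both maps lets a scalar from either factor be pulled out of the
    product in \<open>A\<close>, which gives balancedness.\<close>
  interpret b: balanced_map R H H "add_monoid A" "\<lambda>(x, y). \<chi> x \<otimes>\<^bsub>A\<^esub> \<phi> y"
    by (intro balanced_map.intro H.module_axioms balanced_map_axioms.intro A.a_comm_group)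
      (use lin in \<open>auto simp: Pi_iff A.l_distr A.r_distr A.smult_mult_left A.smult_mult_right\<close>)
  have \<psi>1: "\<psi> \<one>\<^bsub>H\<^esub> \<in> carrier V"
    using \<psi> by (auto simp: hom_along_def linear_maps_def restrict_scalars_def)
  \<comment> \<open>Writing \<open>y\<close> as \<open>y\<close> times the unit shows that \<psi> is
    determined by its value at the unit.\<close>
  have \<psi>_eq: "\<psi> y = \<phi> y \<odot>\<^bsub>V\<^esub> \<psi> \<one>\<^bsub>H\<^esub>" if "y \<in> carrier H" for y
  proof -
    have "\<psi> (y \<otimes>\<^bsub>H\<^esub> \<one>\<^bsub>H\<^esub>) = \<phi> y \<odot>\<^bsub>V\<^esub> \<psi> \<one>\<^bsub>H\<^esub>"
      using \<psi> that H.one_closed unfolding hom_along_def by blast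
    then show ?thesis using that by simp
  qed
  \<comment> \<open>Naturality is applied to this orbit map, which carries the integrand of the
    convolution in \<open>A\<close> to the one in \<open>V\<close>.\<close>
  have \<theta>: "(\<lambda>a. a \<odot>\<^bsub>V\<^esub> \<psi> \<one>\<^bsub>H\<^esub>) \<in> hom (add_monoid A) (add_monoid V)"
    using \<psi>1 by (auto simp: hom_def V.smult_l_distr)
  have "\<Delta> h \<in> carrier (tensor_group R H H)"
    using H.comult_linear h by (auto simp: linear_maps_def tensor_def)
  moreover have "\<chi> x \<odot>\<^bsub>V\<^esub> \<psi> y = (\<chi> x \<otimes>\<^bsub>A\<^esub> \<phi> y) \<odot>\<^bsub>V\<^esub> \<psi> \<one>\<^bsub>H\<^esub>"
    if "x \<in> carrier H" "y \<in> carrier H" for x y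
    using lin \<psi>1 that unfolding \<psi>_eq[OF that(2)] by (simp add: Pi_iff V.smult_assoc1)
  ultimately show ?thesis
    unfolding convolution_def by (intro b.tensor_lift_natural[OF V.a_comm_group \<theta>]) simp_all
qed

theorem theorem5p9:
  fixes R :: "'r ring" and H :: "('r, 'h) module"
    and \<Delta> :: "'h \<Rightarrow> ('h \<times> 'h \<Rightarrow>\<^sub>0 int) set" and \<epsilon> :: "'h \<Rightarrow> 'r" and S :: "'h \<Rightarrow> 'h"
    and Hn :: "nat \<Rightarrow> 'h set"
    and A :: "('r, 'a) module" and Q :: "'a \<Rightarrow> 'a"
    and V :: "('a, 'v) module" and p :: "'v \<Rightarrow> 'v"
    and \<phi> \<phi>m \<phi>p :: "'h \<Rightarrow> 'a" and \<psi> :: "'h \<Rightarrow> 'v"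
  assumes "cring R"
    and "connected_graded_hopf_algebra R H \<Delta> \<epsilon> S Hn"
    and "rota_baxter_algebra R A Q (\<ominus>\<^bsub>R\<^esub> \<one>\<^bsub>R\<^esub>)"
    and "cring A"
    and "\<forall>a\<in>carrier A. Q (Q a) = Q a"
    and "rota_baxter_module R A Q (\<ominus>\<^bsub>R\<^esub> \<one>\<^bsub>R\<^esub>) V p"
    and "\<phi> \<in> alg_hom R H A"
    and "birkhoff_factorization R H \<Delta> A Q (\<ominus>\<^bsub>R\<^esub> \<one>\<^bsub>R\<^esub>) \<phi> \<phi>m \<phi>p"
    and "\<psi> \<in> hom_along R H A \<phi> V"
  shows "let \<psi>p = (\<lambda>h. \<phi>p h \<odot>\<^bsub>V\<^esub> \<psi> \<one>\<^bsub>H\<^esub>);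
        \<psi>m = (\<lambda>h. \<phi>m h \<odot>\<^bsub>V\<^esub> \<psi> \<one>\<^bsub>H\<^esub>)
    in (\<forall>h\<in>carrier H. \<psi>p h = convolution \<Delta> V (smult V) \<phi>m \<psi> h) \<and>
    \<psi>p \<in> hom_along R H (rb_plus R A Q (\<ominus>\<^bsub>R\<^esub> \<one>\<^bsub>R\<^esub>)) \<phi>p
      (generated_submodule (rb_plus R A Q (\<ominus>\<^bsub>R\<^esub> \<one>\<^bsub>R\<^esub>)) V (\<psi> \<one>\<^bsub>H\<^esub>)) \<and>
    \<psi>m \<in> hom_along R H (rb_minus R A Q) \<phi>m
      (generated_submodule (rb_minus R A Q) V (\<psi> \<one>\<^bsub>H\<^esub>))"
proof -
  interpret connected_graded_hopf_algebra R H \<Delta> \<epsilon> S Hn by fact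
  interpret rota_baxter_module R A Q "\<ominus>\<^bsub>R\<^esub> \<one>\<^bsub>R\<^esub>" V p by fact
  let ?v = "\<psi> \<one>\<^bsub>H\<^esub>"
  have v: "?v \<in> carrier V"
    using assms(9) by (auto simp: hom_along_def linear_maps_def restrict_scalars_def)
  have minus: "\<phi>m \<in> alg_hom R H (rb_minus R A Q)"
    and plus: "\<phi>p \<in> alg_hom R H (rb_plus R A Q (\<ominus>\<^bsub>R\<^esub> \<one>\<^bsub>R\<^esub>))"
    and conv: "\<And>h. h \<in> carrier H \<Longrightarrow> \<phi>p h = convolution \<Delta> A (monoid.mult A) \<phi>m \<phi> h"
    using assms(8) by (auto simp: birkhoff_factorization_def)
  have "\<phi>m \<in> linear_maps R H (rb_minus R A Q)"
    using minus by (simp add: alg_hom_def)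
  \<comment> \<open>The codomain is enlarged from \<open>rb_minus R A Q\<close> to \<open>A\<close>,
    with the same operations, because the convolution is formed in \<open>A\<close>.\<close>
  then have "\<phi>m \<in> linear_maps R H A"
    using subsetD[OF Pi_mono[of "carrier H", OF carrier_rb_minus[OF assms(3)]]]
    by (simp add: linear_maps_def rb_minus_def)
  then have "\<phi>p h \<odot>\<^bsub>V\<^esub> ?v = convolution \<Delta> V (smult V) \<phi>m \<psi> h" if "h \<in> carrier H" for h
    using convolution_hom_along[OF assoc_algebra_axioms V.module_axioms bialgebra_axioms _ _ assms(9) that]
      assms(7) conv[OF that] by (simp add: alg_hom_def)
  moreover have "(\<lambda>h. \<phi>p h \<odot>\<^bsub>V\<^esub> ?v) \<in> hom_along R H (rb_plus R A Q (\<ominus>\<^bsub>R\<^esub> \<one>\<^bsub>R\<^esub>)) \<phi>p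
      (generated_submodule (rb_plus R A Q (\<ominus>\<^bsub>R\<^esub> \<one>\<^bsub>R\<^esub>)) V ?v)"
    by (rule alg_hom_orbit_in_hom_along[OF _ V.module_axioms _ carrier_rb_plus[OF assms(3)] plus v])
      (simp_all add: assoc_algebra_axioms rb_plus_def)
  moreover have "(\<lambda>h. \<phi>m h \<odot>\<^bsub>V\<^esub> ?v) \<in> hom_along R H (rb_minus R A Q) \<phi>m
      (generated_submodule (rb_minus R A Q) V ?v)"
    by (rule alg_hom_orbit_in_hom_along[OF _ V.module_axioms _ carrier_rb_minus[OF assms(3)] minus v])
      (simp_all add: assoc_algebra_axioms rb_minus_def)
  ultimately show ?thesis
    by (simp add: Let_def)
qed

end
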